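(* Let $n\ge 2$, let $u\in\mathcal{N}$, and let $Z=(z_{ij})_{1\le i,j\le n}$ be an IPR that is consistent with respect to $u$ and such that the compared objects are ordered from best to worst, i.e., $z_{i(i+1)}\geq_0 u$ for all $i=1,\dots,n-1$. Then the $n$-tuple of intervals given by $v_k=z_{kn}$, $k=1,\dots,n$, satisfies $v_k\geq_0 v_{k+1}$ for all $k=1,\dots,n-1$.
   Context: $\mathcal{I}(\mathbb{R})$ is the set of closed bounded intervals $z=[z^-,z^+]\subseteq\mathbb{R}$ with $z^-\le z^+$ (degenerate intervals $[a,a]$ allowed). Arithmetic: $z_1+z_2=\{x_1+x_2: x_1\in z_1, x_2\in z_2\}$ and $-z=[-z^+,-z^-]$. The partial order is $z_1\le_0 z_2 \iff z_1^-\le z_2^-$ and $z_1^+\le z_2^+$; $z_1\ge_0 z_2$ means $z_2\le_0 z_1$. The set of neutral intervals is $\mathcal{N}=\{[-\varepsilon,\varepsilon]:\varepsilon\ge 0\}$. An interval preference relation (IPR) of order $n$ is an $n\times n$ matrix $Z=(z_{ij})$ with entries $z_{ij}\in\mathcal{I}(\mathbb{R})$ satisfying the reciprocity condition $z_{ij}=-z_{ji}$ for all $i,j=1,\dots,n$. An IPR $Z$ is consistent with respect to $u\in\mathcal{N}$ if $z_{ij}+u=z_{ik}+z_{kj}$ for all $i,j,k=1,\dots,n$. *)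

theory Defs
  imports Complex_Main "HOL-Library.Interval"
begin

text \<open>
  Closed bounded real intervals are the type \<^typ>\<open>real interval\<close>. Its addition is the
  Minkowski sum (\<open>set_of_plus\<close>), and its \<open>uminus\<close> maps the interval
  with bounds \<open>a\<close>, \<open>b\<close> to the one with bounds \<open>- b\<close>, \<open>- a\<close>.
  The library order \<open>\<le>\<close> on intervals is inclusion, so the endpointwise order needs
  its own symbol.
\<close>

definition interval_le0 :: "real interval \<Rightarrow> real interval \<Rightarrow> bool" (infix "\<le>\<^sub>0" 50)
  where "z\<^sub>1 \<le>\<^sub>0 z\<^sub>2 \<longleftrightarrow> lower z\<^sub>1 \<le> lower z\<^sub>2 \<and> upper z\<^sub>1 \<le> upper z\<^sub>2"

abbreviation interval_ge0 :: "real interval \<Rightarrow> real interval \<Rightarrow> bool" (infix "\<ge>\<^sub>0" 50)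
  where "z\<^sub>1 \<ge>\<^sub>0 z\<^sub>2 \<equiv> z\<^sub>2 \<le>\<^sub>0 z\<^sub>1"

definition neutral_intervals :: "real interval set"
  where "neutral_intervals = {z. \<exists>\<epsilon>\<ge>0. set_of z = {-\<epsilon>..\<epsilon>}}"

text \<open>
  An \<open>n \<times> n\<close> matrix of intervals is a function whose values matter only at indices in
  \<open>{1..n}\<close>. Reciprocity at \<open>i = j\<close> makes each diagonal entry neutral, not necessarily zero.
\<close>

definition interval_preference_relation :: "nat \<Rightarrow> (nat \<Rightarrow> nat \<Rightarrow> real interval) \<Rightarrow> bool"
  where "interval_preference_relation n Z \<longleftrightarrow> (\<forall>i\<in>{1..n}. \<forall>j\<in>{1..n}. Z i j = - Z j i)"

definition consistent_wrt ::
    "nat \<Rightarrow> (nat \<Rightarrow> nat \<Rightarrow> real interval) \<Rightarrow> real interval \<Rightarrow> bool"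
  where "consistent_wrt n Z u \<longleftrightarrow>
    (\<forall>i\<in>{1..n}. \<forall>j\<in>{1..n}. \<forall>k\<in>{1..n}. Z i j + u = Z i k + Z k j)"

end

theory Submission
  imports Defs
begin

text \<open>Passing from \<open>k\<close> to \<open>n\<close> through \<open>k + 1\<close>,
  consistency gives \<open>v k + u = Z k (k + 1) + v (k + 1)\<close>. As \<open>Z k (k + 1)\<close>
  dominates \<open>u\<close>, \<open>v k\<close> must dominate \<open>v (k + 1)\<close> to balance
  the sums; \<open>le0_if_add_eq_add\<close> is this comparison.\<close>

lemma le0_if_add_eq_add:
  assumes "a + u = b + c" and "u \<le>\<^sub>0 b"
  shows "c \<le>\<^sub>0 a"
proof -
  \<comment> \<open>Intervals lack additive inverses, so \<open>u\<close> is cancelled at the real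
    endpoints, which add separately.\<close>
  have "lower a + lower u = lower b + lower c" "upper a + upper u = upper b + upper c"
    using assms(1) by (metis lower_plus, metis upper_plus)
  with assms(2) show ?thesis
    unfolding interval_le0_def by linarith
qed

theorem proposition2:
  fixes n :: nat
    and u :: "real interval"
    and Z :: "nat \<Rightarrow> nat \<Rightarrow> real interval"
    and v :: "nat \<Rightarrow> real interval"
  assumes "n \<ge> 2"
    and "u \<in> neutral_intervals"
    and "interval_preference_relation n Z"
    and "consistent_wrt n Z u"
    and "\<forall>i\<in>{1..n-1}. Z i (i + 1) \<ge>\<^sub>0 u"
    and "\<forall>k\<in>{1..n}. v k = Z k n"
  shows "\<forall>k\<in>{1..n-1}. v k \<ge>\<^sub>0 v (k + 1)"
proof
  fix k assume k: "k \<in> {1..n-1}"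
  then have "k \<in> {1..n}" "k + 1 \<in> {1..n}" "n \<in> {1..n}"
    by auto
  \<comment> \<open>Consistency for the pair \<open>k\<close>, \<open>n\<close> with intermediate
    index \<open>k + 1\<close>. If \<open>k + 1 = n\<close>, then \<open>v (k + 1)\<close> is the
    diagonal entry \<open>Z n n\<close>.\<close>
  with assms(4,6) have "v k + u = Z k (k + 1) + v (k + 1)"
    unfolding consistent_wrt_def by metis
  moreover have "Z k (k + 1) \<ge>\<^sub>0 u"
    using assms(5) k by blast
  ultimately show "v k \<ge>\<^sub>0 v (k + 1)"
    by (rule le0_if_add_eq_add)
qed

end
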